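(* Let $G$ be a finite connected metric tree with edge lengths $\ell\in(0,\infty)^E$, with every degree-one vertex treated as an exterior boundary vertex and every internal vertex carrying the Kirchhoff condition; exterior vertices may carry either Dirichlet or Neumann boundary conditions. If $r$ is the edge-energy vector of any regular secular state on $G$, then $$r\in\mathcal M_G^{\mathrm{bc}}.$$ More precisely, there exist finitely many real vectors $A^{(1)},\dots,A^{(N)}\in\ker B_0$ such that $$r=\sum_{j=1}^N\bigl(A^{(j)}\bigr)^{\circ2}.$$ Consequently, for every $\alpha\in[0,\infty)^E$, $$\frac{\alpha\cdot r}{\ell\cdot r}\ge C_{\mathrm{sing}}(\alpha;\ell).$$
   Context: **Graphs.** The vertices of $G=(V,E)$ are split into internal vertices $V_{\mathrm{int}}$ (degree at least two, standard Kirchhoff condition) and exterior vertices (exactly the degree-one vertices). Every edge has at least one internal endpoint. Orient the edges, terminal edges from the internal to the exterior endpoint. $B_0\in\mathbb R^{V_{\mathrm{int}}\times E}$ is the ordinary oriented incidence matrix restricted to internal rows: an internal--internal edge from $v_-$ to $v_+$ has entries $+1$ in row $v_-$ and $-1$ in row $v_+$; a terminal edge at $v$ has the single entry $+1$ in row $v$. **Singular cone.** A boundary-compatible singular sector $\sigma$ consists of: a parity $\sigma_e=\cos\theta_e\in\{\pm1\}$, $\theta_e\in\pi\mathbb Z$, for each internal--internal edge; a phase class $\theta_e\in\pi\mathbb Z$ for each internal--Dirichlet edge; a phase class $\theta_e\in\frac\pi2+\pi\mathbb Z$ for each internal--Neumann edge. $B_{\sigma,\mathrm{bc}}\in\mathbb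 R^{V_{\mathrm{int}}\times E}$ has: for an internal--internal edge from $v_-$ to $v_+$, entries $1$ in row $v_-$ and $-\sigma_e$ in row $v_+$; for a terminal edge at internal vertex $v$, entry $1$ in row $v$; all other entries zero. With $A^{\circ2}=(A_e^2)_e$, $\mathcal M_G^{\mathrm{bc}}$ is the convex cone generated by $\bigcup_\sigma\{A^{\circ2}:A\in\ker B_{\sigma,\mathrm{bc}}\}$. $$C_{\mathrm{sing}}(\alpha;\ell)=\min_\sigma\ \inf_{0\ne A\in\ker B_{\sigma,\mathrm{bc}}}\frac{\sum_e\alpha_eA_e^2}{\sum_e\ell_eA_e^2}$$ (sectors with trivial kernel omitted). **Regular secular states.** A regular secular state at a phase vector $\theta\in(\mathbb R/2\pi\mathbb Z)^E$ consists of real vertex values $\phi_v$ ($v\in V_{\mathrm{int}}$) and real normalized outward derivatives $p_{v,e}$, one for each incidence of an edge with an internal vertex, not all zero, such that: $\sum_{e\sim v}p_{v,e}=0$ at each internal vertex; for each internal--internal edge $e=vw$, $\theta_e\notin\pi\mathbb Z$, $\phi_w=\phi_v\cos\theta_e+p_{v,e}\sin\theta_e$ and $-p_{w,e}=-\phi_v\sin\theta_e+p_{v,e}\cos\theta_e$; for each terminal edge at $v$, $\phi_v\cos\theta_e+p_{v,e}\sin\theta_e=0$ (Dirichlet) or $-\phi_v\sin\theta_e+p_{v,e}\cos\theta_e=0$ (Neumann). Its edge-energy vector is $r_e=\phi_v^2+p_{v,e}^2$ (the same at both internal endpoints); it equals $|A_e|^2+|B_e|^2$ for $u_e(x)=A_e\cos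 kx+B_e\sin kx$, $k\ell_e\equiv\theta_e$. *)

theory Defs
  imports "HOL-Analysis.Analysis"
begin

datatype boundary_condition = Dirichlet | Neumann

text \<open>
  A finite graph with vertex set \<open>'i + 'x\<close>: the type \<open>'i\<close> consists of the internal vertices, \<open>'x\<close>
  of the exterior ones, and \<open>'e\<close> of the edges. Edges are oriented. Every edge has an internal
  endpoint and terminal edges point outwards, so the source can be taken in \<open>'i\<close>; a terminal edge
  is one whose target is of the form \<open>Inr x\<close>.
\<close>

record ('i, 'x, 'e) quantum_graph =
  src :: "'e \<Rightarrow> 'i"
  tgt :: "'e \<Rightarrow> 'i + 'x"
  bc :: "'x \<Rightarrow> boundary_condition"

definition joins :: "('i, 'x, 'e) quantum_graph \<Rightarrow> 'e \<Rightarrow> 'i + 'x \<Rightarrow> 'i + 'x \<Rightarrow> bool" where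
  "joins G e u v \<longleftrightarrow>
     (Inl (src G e) = u \<and> tgt G e = v) \<or> (Inl (src G e) = v \<and> tgt G e = u)"

definition degree :: "('i, 'x, 'e::finite) quantum_graph \<Rightarrow> 'i + 'x \<Rightarrow> nat" where
  "degree G v = card {e. Inl (src G e) = v} + card {e. tgt G e = v}"

definition connected_graph :: "('i, 'x, 'e) quantum_graph \<Rightarrow> bool" where
  "connected_graph G \<longleftrightarrow> (\<forall>u v. (u, v) \<in> {(a, b). \<exists>e. joins G e a b}\<^sup>*)"

fun walk :: "('i, 'x, 'e) quantum_graph \<Rightarrow> ('i + 'x) list \<Rightarrow> 'e list \<Rightarrow> bool" where
  "walk G [v] [] \<longleftrightarrow> True"
| "walk G (u # v # vs) (e # es) \<longleftrightarrow> joins G e u v \<and> walk G (v # vs) es"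
| "walk G _ _ \<longleftrightarrow> False"

text \<open>
  The edges are required to be distinct, since going back and forth along one edge is not a cycle
  in an undirected graph. Loops and pairs of parallel edges are cycles.
\<close>

definition cycle :: "('i, 'x, 'e) quantum_graph \<Rightarrow> ('i + 'x) list \<Rightarrow> 'e list \<Rightarrow> bool" where
  "cycle G vs es \<longleftrightarrow>
     walk G vs es \<and> es \<noteq> [] \<and> hd vs = last vs \<and> distinct (tl vs) \<and> distinct es"

definition quantum_tree :: "('i, 'x, 'e::finite) quantum_graph \<Rightarrow> bool" where
  "quantum_tree G \<longleftrightarrow>
     connected_graph G \<and> (\<nexists>vs es. cycle G vs es) \<and>
     (\<forall>v. degree G (Inl v) \<ge> 2) \<and> (\<forall>x. degree G (Inr x) = 1)"

definition B0 :: "('i::finite, 'x, 'e::finite) quantum_graph \<Rightarrow> real ^ 'e ^ 'i" where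
  "B0 G = (\<chi> v e. if src G e = v then 1 else if tgt G e = Inl v then - 1 else 0)"

definition pi_multiples :: "real set" where
  "pi_multiples = {of_int k * pi | k. True}"

text \<open>
  A sector is given by real representatives of its phases; the parity of an internal-internal edge
  is the cosine of its phase.
\<close>

definition singular_sector :: "('i::finite, 'x, 'e::finite) quantum_graph \<Rightarrow> real ^ 'e \<Rightarrow> bool" where
  "singular_sector G \<theta> \<longleftrightarrow>
     (\<forall>e. case tgt G e of
        Inl w \<Rightarrow> \<theta> $ e \<in> pi_multiples
      | Inr x \<Rightarrow> (case bc G x of
            Dirichlet \<Rightarrow> \<theta> $ e \<in> pi_multiples
          | Neumann \<Rightarrow> \<theta> $ e - pi / 2 \<in> pi_multiples))"

definition Bsing :: "('i::finite, 'x, 'e::finite) quantum_graph \<Rightarrow> real ^ 'e \<Rightarrow> real ^ 'e ^ 'i" where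
  "Bsing G \<theta> =
     (\<chi> v e. if src G e = v then 1 else if tgt G e = Inl v then - cos (\<theta> $ e) else 0)"

definition kernel :: "real ^ 'e::finite ^ 'i::finite \<Rightarrow> (real ^ 'e) set" where
  "kernel B = {A. B *v A = 0}"

definition sq :: "real ^ 'e \<Rightarrow> real ^ 'e" where
  "sq A = (\<chi> e. (A $ e)\<^sup>2)"

definition singular_cone :: "('i::finite, 'x, 'e::finite) quantum_graph \<Rightarrow> (real ^ 'e) set" where
  "singular_cone G = convex_cone hull (\<Union>\<theta>\<in>{\<theta>. singular_sector G \<theta>}. sq ` kernel (Bsing G \<theta>))"

definition sector_inf ::
  "('i::finite, 'x, 'e::finite) quantum_graph \<Rightarrow> real ^ 'e \<Rightarrow> real ^ 'e \<Rightarrow> real ^ 'e \<Rightarrow> real" where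
  "sector_inf G \<alpha> l \<theta> =
     (INF A\<in>kernel (Bsing G \<theta>) - {0}.
        (\<Sum>e\<in>UNIV. \<alpha> $ e * (A $ e)\<^sup>2) / (\<Sum>e\<in>UNIV. l $ e * (A $ e)\<^sup>2))"

definition C_sing ::
  "('i::finite, 'x, 'e::finite) quantum_graph \<Rightarrow> real ^ 'e \<Rightarrow> real ^ 'e \<Rightarrow> real" where
  "C_sing G \<alpha> l =
     Min (sector_inf G \<alpha> l ` {\<theta>. singular_sector G \<theta> \<and> kernel (Bsing G \<theta>) \<noteq> {0}})"

text \<open>The minimum ranges over a finite set: only the parities enter the matrix of a sector.\<close>

lemma finite_Bsing:
  fixes G :: "('i::finite, 'x, 'e::finite) quantum_graph"
  shows "finite (Bsing G ` {\<theta>. singular_sector G \<theta>})"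
proof -
  let ?M = "\<lambda>s :: 'e \<Rightarrow> real. (\<chi> v e. if src G e = v then 1
              else if tgt G e = Inl v then - s e else 0) :: real ^ 'e ^ 'i"
  have "Bsing G \<theta> \<in> ?M ` (UNIV \<rightarrow>\<^sub>E {-1, 1})" if "singular_sector G \<theta>" for \<theta>
  proof
    define s where "s = (\<lambda>e. if isl (tgt G e) then cos (\<theta> $ e) else 1)"
    have "cos (\<theta> $ e) \<in> {-1, 1}" if "isl (tgt G e)" for e
    proof -
      have "\<theta> $ e \<in> pi_multiples"
        using \<open>singular_sector G \<theta>\<close>[unfolded singular_sector_def, rule_format, of e] that
        by (auto split: sum.splits)
      then show ?thesis
        by (auto simp: pi_multiples_def mult.commute cos_int_times_real abs_if
            split: if_splits)
    qed
    then have "s e \<in> {-1, 1}" for e by (cases "isl (tgt G e)") (simp_all add: s_def)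
    then show "s \<in> UNIV \<rightarrow>\<^sub>E {-1, 1}" by (simp add: PiE_def Pi_def)
    show "Bsing G \<theta> = ?M s" by (auto simp: Bsing_def s_def vec_eq_iff)
  qed
  moreover have "finite (?M ` (UNIV \<rightarrow>\<^sub>E {-1, 1}))"
    by (intro finite_imageI finite_PiE) auto
  ultimately show ?thesis by (auto intro: finite_subset)
qed

lemma finite_sector_inf:
  fixes G :: "('i::finite, 'x, 'e::finite) quantum_graph"
  shows "finite (sector_inf G \<alpha> l ` {\<theta>. singular_sector G \<theta> \<and> kernel (Bsing G \<theta>) \<noteq> {0}})"
proof -
  let ?h = "\<lambda>B :: real ^ 'e ^ 'i. INF A\<in>kernel B - {0}.
        (\<Sum>e\<in>UNIV. \<alpha> $ e * (A $ e)\<^sup>2) / (\<Sum>e\<in>UNIV. l $ e * (A $ e)\<^sup>2)"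
  have "sector_inf G \<alpha> l ` {\<theta>. singular_sector G \<theta> \<and> kernel (Bsing G \<theta>) \<noteq> {0}}
          \<subseteq> ?h ` (Bsing G ` {\<theta>. singular_sector G \<theta>})"
    by (auto simp: sector_inf_def)
  then show ?thesis
    using finite_Bsing finite_subset by blast
qed

text \<open>
  The phase vector is given by a real representative; all conditions are \<open>2\<pi>\<close>-periodic in it.
  The value \<open>p v e\<close> is meaningful only if \<open>e\<close> is incident with \<open>v\<close>.
\<close>

definition incident :: "('i, 'x, 'e) quantum_graph \<Rightarrow> 'i \<Rightarrow> 'e \<Rightarrow> bool" where
  "incident G v e \<longleftrightarrow> src G e = v \<or> tgt G e = Inl v"

definition regular_secular_state ::
  "('i::finite, 'x, 'e::finite) quantum_graph \<Rightarrow> real ^ 'e \<Rightarrow> ('i \<Rightarrow> real) \<Rightarrow> ('i \<Rightarrow> 'e \<Rightarrow> real) \<Rightarrow> bool"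
where
  "regular_secular_state G \<theta> \<phi> p \<longleftrightarrow>
     ((\<exists>v. \<phi> v \<noteq> 0) \<or> (\<exists>v e. incident G v e \<and> p v e \<noteq> 0)) \<and>
     (\<forall>v. (\<Sum>e | incident G v e. p v e) = 0) \<and>
     (\<forall>e. let v = src G e in
        case tgt G e of
          Inl w \<Rightarrow>
            \<theta> $ e \<notin> pi_multiples \<and>
            \<phi> w = \<phi> v * cos (\<theta> $ e) + p v e * sin (\<theta> $ e) \<and>
            - p w e = - \<phi> v * sin (\<theta> $ e) + p v e * cos (\<theta> $ e)
        | Inr x \<Rightarrow> (case bc G x of
              Dirichlet \<Rightarrow> \<phi> v * cos (\<theta> $ e) + p v e * sin (\<theta> $ e) = 0
            | Neumann \<Rightarrow> - \<phi> v * sin (\<theta> $ e) + p v e * cos (\<theta> $ e) = 0))"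

definition edge_energy ::
  "('i::finite, 'x, 'e::finite) quantum_graph \<Rightarrow> ('i \<Rightarrow> real) \<Rightarrow> ('i \<Rightarrow> 'e \<Rightarrow> real) \<Rightarrow> real ^ 'e" where
  "edge_energy G \<phi> p = (\<chi> e. (\<phi> (src G e))\<^sup>2 + (p (src G e) e)\<^sup>2)"

text \<open>The energy of an edge may be computed at either internal endpoint.\<close>

lemma edge_energy_incident:
  assumes "regular_secular_state G \<theta> \<phi> p" "incident G v e"
  shows "edge_energy G \<phi> p $ e = (\<phi> v)\<^sup>2 + (p v e)\<^sup>2"
proof (cases "src G e = v")
  case False
  then have t: "tgt G e = Inl v" using assms(2) by (simp add: incident_def)
  let ?a = "\<phi> (src G e)" and ?b = "p (src G e) e"
  have *: "\<phi> v = ?a * cos (\<theta> $ e) + ?b * sin (\<theta> $ e)"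
    "p v e = ?a * sin (\<theta> $ e) - ?b * cos (\<theta> $ e)"
    using assms(1) t by (auto simp: regular_secular_state_def Let_def dest!: spec[of _ e])
  have "(\<phi> v)\<^sup>2 + (p v e)\<^sup>2 = (?a\<^sup>2 + ?b\<^sup>2) * ((sin (\<theta> $ e))\<^sup>2 + (cos (\<theta> $ e))\<^sup>2)"
    unfolding * by algebra
  then show ?thesis by (simp add: edge_energy_def)
qed (simp add: edge_energy_def)

end

theory Submission
  imports Defs
begin

text \<open>
  The idea is to allow the amplitudes \<open>A\<^sub>e\<close> of a flow in \<open>ker B\<^sub>0\<close> to be vectors of a Euclidean
  space rather than numbers. The coordinates of a vector-valued flow with \<open>\<parallel>A\<^sub>e\<parallel>\<^sup>2 = r\<^sub>e\<close> are
  real elements of \<open>ker B\<^sub>0\<close>, and their squares add up to \<open>r\<close>.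

  At a single internal vertex \<open>v\<close> of degree \<open>d\<close> such a flow can be written down. Attach to the
  edges at \<open>v\<close> the \<open>d\<close>-th roots of unity \<open>\<omega>\<^sub>e\<close> in some order, and give the edge \<open>e\<close> the vector
  \<open>(\<phi>\<^sub>v \<omega>\<^sub>e, p\<^sub>v\<^sub>,\<^sub>e) \<in> \<complex> \<times> \<real> = \<real>\<^sup>3\<close>. Its squared length is \<open>\<phi>\<^sub>v\<^sup>2 + p\<^sub>v\<^sub>,\<^sub>e\<^sup>2 = r\<^sub>e\<close>. The vectors at \<open>v\<close>
  sum to zero: the \<open>p\<close>-parts by the Kirchhoff condition, the roots of unity because \<open>d \<ge> 2\<close>
  (\<open>local_flow\<close>).

  An internal edge receives one vector from each of its endpoints. Both have length \<open>\<surd>r\<^sub>e\<close>, so an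
  orthogonal map takes one to the negative of the other. Applying an orthogonal map to all the
  vectors at a vertex preserves lengths and the zero sum. Since the graph has no cycles, one
  orthogonal map can be chosen at each vertex such that the two vectors on each edge become opposite
  (\<open>gluing_on_forest\<close>), and the local flows then form one global flow.

  The kernel of \<open>B\<^sub>0\<close> is that of the sector with all parities \<open>+1\<close>, which gives membership in the
  cone. Each of the squares satisfies the bound by \<open>C_sing\<close>, and the bound passes to their sum.
\<close>

section \<open>Cycles from paths\<close>

lemma walk_suffix:
  "walk G (xs @ a # ys) es \<Longrightarrow> \<exists>fs. walk G (a # ys) fs \<and> set fs \<subseteq> set es"
proof (induction xs arbitrary: es)
  case Nil
  then show ?case by auto
next
  case (Cons x xs)
  obtain y zs where yz: "xs @ a # ys = y # zs" by (cases "xs @ a # ys") auto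
  with Cons.prems obtain e fs where "es = e # fs" by (cases es) auto
  with Cons.prems yz have "walk G (xs @ a # ys) fs" by simp
  from Cons.IH[OF this] show ?case using \<open>es = e # fs\<close> by auto
qed

lemma walk_covers_endpoints:
  "walk G vs es \<Longrightarrow> e \<in> set es \<Longrightarrow> joins G e x y \<Longrightarrow> x \<in> set vs"
  by (induction G vs es rule: walk.induct) (auto simp: joins_def)

lemma walk_distinct_edges:
  "walk G vs es \<Longrightarrow> distinct vs \<Longrightarrow> distinct es"
proof (induction G vs es rule: walk.induct)
  case (2 G u v vs e es)
  then have "e \<notin> set es" using walk_covers_endpoints[of G "v # vs" es e u v] by auto
  with 2 show ?case by simp
qed auto

lemma rtrancl_imp_path:
  assumes "(a, b) \<in> {(a, b). \<exists>e\<in>S. joins G e a b}\<^sup>*"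
  shows "\<exists>vs es. walk G (a # vs) es \<and> last (a # vs) = b \<and> distinct (a # vs) \<and> set es \<subseteq> S"
  using assms
proof (induction rule: converse_rtrancl_induct)
  case base
  show ?case by (intro exI[of _ "[]"]) simp
next
  case (step a c)
  then obtain vs es where c: "walk G (c # vs) es" "last (c # vs) = b" "distinct (c # vs)"
    "set es \<subseteq> S" by (elim exE conjE)
  from step(1) obtain f where f: "f \<in> S" "joins G f a c" by auto
  show ?case
  proof (cases "a \<in> set (c # vs)")
    case True
    \<comment> \<open>The walk returns to \<open>a\<close>; what precedes the return is cut off.\<close>
    then obtain xs ys where xs: "c # vs = xs @ a # ys" by (meson split_list)
    with c(1) obtain fs where "walk G (a # ys) fs" "set fs \<subseteq> set es"
      by (metis walk_suffix)
    moreover have "last (a # ys) = b" "distinct (a # ys)" using c(2,3) xs by auto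
    ultimately show ?thesis using c(4) by (intro exI[of _ ys] exI[of _ fs]) auto
  next
    case False
    show ?thesis using c f False by (intro exI[of _ "c # vs"] exI[of _ "f # es"]) auto
  qed
qed

text \<open>The degenerate case \<open>u = w\<close> is included: the path is then trivial and the cycle a loop.\<close>

lemma cycle_from_extra_edge:
  assumes "(w, u) \<in> {(a, b). \<exists>e\<in>S. joins G e a b}\<^sup>*" "e \<notin> S" "joins G e u w"
  shows "\<exists>vs es. cycle G vs es"
proof -
  obtain vs es where c: "walk G (w # vs) es" "last (w # vs) = u" "distinct (w # vs)" "set es \<subseteq> S"
    using rtrancl_imp_path[OF assms(1)] by blast
  have "cycle G (u # w # vs) (e # es)"
    using c assms(2,3) walk_distinct_edges[OF c(1,3)] by (auto simp: cycle_def)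
  then show ?thesis by blast
qed

section \<open>Gluing local vectors along a forest\<close>

text \<open>
  The edges are added one at a time. A new edge joins two different components of the forest built
  so far, and moving one component by a single orthogonal map keeps all its old edges matched while
  the map is free to match the new edge.
\<close>

lemma gluing_on_forest:
  fixes G :: "('i, 'x, 'e::finite) quantum_graph" and a :: "'i \<Rightarrow> 'e \<Rightarrow> real ^ 'n"
  assumes acyclic: "\<nexists>vs es. cycle G vs es"
    and norms: "\<And>e w. tgt G e = Inl w \<Longrightarrow> norm (a (src G e) e) = norm (a w e)"
  shows "\<exists>T :: 'i \<Rightarrow> real ^ 'n \<Rightarrow> real ^ 'n. (\<forall>v. orthogonal_transformation (T v)) \<and>
    (\<forall>e w. tgt G e = Inl w \<longrightarrow> T w (a w e) = - T (src G e) (a (src G e) e))"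
proof -
  have "\<exists>T :: 'i \<Rightarrow> real ^ 'n \<Rightarrow> real ^ 'n. (\<forall>v. orthogonal_transformation (T v)) \<and>
    (\<forall>e\<in>S. \<forall>w. tgt G e = Inl w \<longrightarrow> T w (a w e) = - T (src G e) (a (src G e) e))" for S
  proof (induction S rule: finite_induct[OF finite])
    case 1
    show ?case by (rule exI[of _ "\<lambda>_ x. x"]) (simp add: orthogonal_transformation linear_ident)
  next
    case (2 e S)
    then obtain T :: "'i \<Rightarrow> real ^ 'n \<Rightarrow> real ^ 'n"
      where orth: "\<And>v. orthogonal_transformation (T v)"
      and T: "\<And>f y. f \<in> S \<Longrightarrow> tgt G f = Inl y \<Longrightarrow> T y (a y f) = - T (src G f) (a (src G f) f)"
      by blast
    show ?case
    proof (cases "tgt G e")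
      case (Inr x)
      with orth T show ?thesis by (intro exI[of _ T]) auto
    next
      case (Inl w)
      define u where "u = src G e"
      define R where "R = {(a, b). \<exists>e\<in>S. joins G e a b}\<^sup>*"
      have "norm (T w (a w e)) = norm (- T u (a u e))"
        using norms[OF Inl] orth by (simp add: u_def orthogonal_transformation_norm)
      then obtain Q where Q: "orthogonal_transformation Q" "Q (T w (a w e)) = - T u (a u e)"
        using orthogonal_transformation_exists by blast
      define T' where "T' x = (if (Inl w, Inl x) \<in> R then Q \<circ> T x else T x)" for x
      have "orthogonal_transformation (T' v)" for v
        using orth Q(1) by (simp add: T'_def orthogonal_transformation_compose)
      moreover have "T' y (a y f) = - T' (src G f) (a (src G f) f)"
        if f: "f \<in> insert e S" "tgt G f = Inl y" for f y
      proof (cases "f = e")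
        case True
        have "(Inl w, Inl u) \<notin> R"
          using cycle_from_extra_edge[of "Inl w" "Inl u" S G e] acyclic 2 Inl
          by (auto simp: R_def u_def joins_def)
        moreover have "(Inl w, Inl w) \<in> R" by (simp add: R_def)
        ultimately show ?thesis using True f(2) Inl Q(2) by (simp add: T'_def u_def)
      next
        case False
        then have fS: "f \<in> S" using f by simp
        have "joins G f (Inl y) (Inl (src G f))" "joins G f (Inl (src G f)) (Inl y)"
          using f(2) by (auto simp: joins_def)
        then have "(Inl w, Inl y) \<in> R \<longleftrightarrow> (Inl w, Inl (src G f)) \<in> R"
          using fS unfolding R_def by (blast intro: rtrancl_into_rtrancl)
        then show ?thesis
          using T[OF fS f(2)] linear_neg[OF orthogonal_transformation_linear[OF Q(1)]]
          by (simp add: T'_def)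
      qed
      ultimately show ?thesis by blast
    qed
  qed
  from this[of UNIV] show ?thesis by simp
qed

section \<open>The vector-valued flow\<close>

lemma no_loops:
  assumes "\<nexists>vs es. cycle G vs es"
  shows "tgt G e \<noteq> Inl (src G e)"
proof
  assume "tgt G e = Inl (src G e)"
  then have "cycle G [Inl (src G e), Inl (src G e)] [e]" by (simp add: cycle_def joins_def)
  then show False using assms by blast
qed

lemma card_incident:
  fixes G :: "('i::finite, 'x, 'e::finite) quantum_graph"
  assumes "quantum_tree G"
  shows "card {e. incident G v e} \<ge> 2"
proof -
  have "{e. incident G v e} = {e. src G e = v} \<union> {e. tgt G e = Inl v}"
    by (auto simp: incident_def)
  moreover have "{e. src G e = v} \<inter> {e. tgt G e = Inl v} = {}"
    using assms no_loops[of G] by (auto simp: quantum_tree_def)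
  ultimately have "card {e. incident G v e} = degree G (Inl v)"
    by (simp add: card_Un_disjoint degree_def)
  then show ?thesis using assms by (simp add: quantum_tree_def)
qed

lemma local_flow:
  fixes p :: "'e \<Rightarrow> real" and \<phi> :: real
  assumes "card I \<ge> 2" "(\<Sum>e\<in>I. p e) = 0"
  obtains a :: "'e \<Rightarrow> real ^ 3"
  where "(\<Sum>e\<in>I. a e) = 0" "\<And>e. e \<in> I \<Longrightarrow> (norm (a e))\<^sup>2 = \<phi>\<^sup>2 + (p e)\<^sup>2"
proof -
  let ?R = "{z::complex. z ^ card I = 1}"
  have "card ?R = card I" using assms by (intro card_roots_unity_eq) simp
  moreover have "finite I" "finite ?R" using assms calculation by (auto intro: card_ge_0_finite)
  ultimately obtain z where z: "bij_betw z I ?R"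
    by (metis finite_same_card_bij)
  have "(\<Sum>e\<in>I. z e) = \<Sum>?R" using sum.reindex_bij_betw[OF z, of "\<lambda>x. x"] by simp
  also have "\<dots> = 0" using assms by (intro sum_roots_unity) simp
  finally have sum_z: "(\<Sum>e\<in>I. Re (z e)) = 0" "(\<Sum>e\<in>I. Im (z e)) = 0"
    by (simp_all flip: Re_sum Im_sum)
  have norm_z: "(Re (z e))\<^sup>2 + (Im (z e))\<^sup>2 = 1" if "e \<in> I" for e
  proof -
    have "z e ^ card I = 1" using z that by (auto simp: bij_betw_def)
    then have "norm (z e) = 1" using assms power_eq_1_iff[of "z e" "card I"] by auto
    then show ?thesis by (metis cmod_power2 one_power2)
  qed
  define a :: "'e \<Rightarrow> real ^ 3" where "a e = vector [\<phi> * Re (z e), \<phi> * Im (z e), p e]" for e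
  show thesis
  proof (rule that)
    show "(\<Sum>e\<in>I. a e) = 0"
      using assms sum_z by (simp add: vec_eq_iff forall_3 a_def flip: sum_distrib_left)
    show "(norm (a e))\<^sup>2 = \<phi>\<^sup>2 + (p e)\<^sup>2" if "e \<in> I" for e
    proof -
      have "(norm (a e))\<^sup>2 = \<phi>\<^sup>2 * ((Re (z e))\<^sup>2 + (Im (z e))\<^sup>2) + (p e)\<^sup>2"
        unfolding power2_norm_eq_inner
        by (simp add: inner_vec_def sum_3 a_def power2_eq_square algebra_simps)
      then show ?thesis using norm_z[OF that] by simp
    qed
  qed
qed

text \<open>
  The columns of \<open>B\<^sub>0\<close> carry opposite signs at the two ends of an internal edge. This is why the
  two vectors on an edge are made opposite rather than equal: measured from \<open>v\<close>, the flow on each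
  incident edge is then the outward vector at \<open>v\<close>, whatever the orientation.
\<close>

lemma vector_flow_exists:
  fixes G :: "('i::finite, 'x, 'e::finite) quantum_graph"
  assumes tree: "quantum_tree G" and state: "regular_secular_state G \<theta> \<phi> p"
  obtains X :: "'e \<Rightarrow> real ^ 3"
  where "\<And>e. (norm (X e))\<^sup>2 = edge_energy G \<phi> p $ e"
    and "\<And>v. (\<Sum>e\<in>UNIV. (B0 G $ v $ e) *\<^sub>R X e) = 0"
proof -
  have "\<exists>a :: 'e \<Rightarrow> real ^ 3. (\<Sum>e | incident G v e. a e) = 0 \<and>
      (\<forall>e. incident G v e \<longrightarrow> (norm (a e))\<^sup>2 = (\<phi> v)\<^sup>2 + (p v e)\<^sup>2)" for v
  proof -
    have "(\<Sum>e | incident G v e. p v e) = 0" using state by (simp add: regular_secular_state_def)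
    from local_flow[OF card_incident[OF tree] this, of "\<phi> v"] show ?thesis by auto
  qed
  then obtain a :: "'i \<Rightarrow> 'e \<Rightarrow> real ^ 3" where a0: "\<And>v. (\<Sum>e | incident G v e. a v e) = 0"
    and "\<And>v e. incident G v e \<Longrightarrow> (norm (a v e))\<^sup>2 = (\<phi> v)\<^sup>2 + (p v e)\<^sup>2"
    by metis
  then have a_norm: "(norm (a v e))\<^sup>2 = edge_energy G \<phi> p $ e" if "incident G v e" for v e
    using edge_energy_incident[OF state that] that by simp
  have inc: "incident G (src G e) e" for e by (simp add: incident_def)
  have no_cycle: "\<nexists>vs es. cycle G vs es" using tree by (simp add: quantum_tree_def)
  have "norm (a (src G e) e) = norm (a w e)" if "tgt G e = Inl w" for e w
  proof -
    have "incident G w e" using that by (simp add: incident_def)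
    then have "(norm (a (src G e) e))\<^sup>2 = (norm (a w e))\<^sup>2" using a_norm inc by simp
    then show ?thesis by simp
  qed
  from gluing_on_forest[OF no_cycle, of a, OF this]
  obtain T :: "'i \<Rightarrow> real ^ 3 \<Rightarrow> real ^ 3" where orth: "\<And>v. orthogonal_transformation (T v)"
    and T: "\<And>e w. tgt G e = Inl w \<Longrightarrow> T w (a w e) = - T (src G e) (a (src G e) e)"
    by blast
  define X where "X e = T (src G e) (a (src G e) e)" for e
  show thesis
  proof (rule that[of X])
    show "(norm (X e))\<^sup>2 = edge_energy G \<phi> p $ e" for e
      by (simp add: X_def orthogonal_transformation_norm[OF orth] a_norm inc)
    show "(\<Sum>e\<in>UNIV. (B0 G $ v $ e) *\<^sub>R X e) = 0" for v
    proof -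
      have "(B0 G $ v $ e) *\<^sub>R X e = (if incident G v e then T v (a v e) else 0)" for e
      proof (cases "src G e = v")
        case True
        then show ?thesis by (simp add: B0_def X_def incident_def)
      next
        case False
        then show ?thesis using T[of e v] by (cases "tgt G e = Inl v")
          (simp_all add: B0_def X_def incident_def)
      qed
      then have "(\<Sum>e\<in>UNIV. (B0 G $ v $ e) *\<^sub>R X e) = (\<Sum>e | incident G v e. T v (a v e))"
        by (simp add: sum.If_cases)
      also have "\<dots> = T v (\<Sum>e | incident G v e. a v e)"
        by (simp add: linear_sum[OF orthogonal_transformation_linear[OF orth]])
      also have "\<dots> = 0"
        by (simp add: a0 linear_0[OF orthogonal_transformation_linear[OF orth]])
      finally show ?thesis .
    qed
  qed
qed

lemma edge_energy_decomposition:
  fixes G :: "('i::finite, 'x, 'e::finite) quantum_graph"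
  assumes "quantum_tree G" "regular_secular_state G \<theta> \<phi> p"
  obtains N :: nat and A
  where "\<And>j. j \<in> {1..N} \<Longrightarrow> A j \<in> kernel (B0 G)" "edge_energy G \<phi> p = (\<Sum>j=1..N. sq (A j))"
proof -
  obtain X :: "'e \<Rightarrow> real ^ 3" where X: "\<And>e. (norm (X e))\<^sup>2 = edge_energy G \<phi> p $ e"
    and X0: "\<And>v. (\<Sum>e\<in>UNIV. (B0 G $ v $ e) *\<^sub>R X e) = 0"
    using vector_flow_exists[OF assms] by blast
  define C :: "3 \<Rightarrow> real ^ 'e" where "C i = (\<chi> e. X e $ i)" for i
  have ker: "C i \<in> kernel (B0 G)" for i
  proof -
    have "(B0 G *v C i) $ v = (\<Sum>e\<in>UNIV. (B0 G $ v $ e) *\<^sub>R X e) $ i" for v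
      by (simp add: matrix_vector_mult_def C_def)
    then show ?thesis by (simp add: kernel_def vec_eq_iff X0)
  qed
  have sum: "edge_energy G \<phi> p = (\<Sum>i\<in>UNIV. sq (C i))"
    unfolding vec_eq_iff X[symmetric] power2_norm_eq_inner
    by (simp add: sq_def C_def inner_vec_def power2_eq_square)
  obtain f where f: "bij_betw f {1..CARD(3)} (UNIV :: 3 set)"
    using ex_bij_betw_nat_finite_1[OF finite, of "UNIV :: 3 set"] by blast
  show thesis
  proof (rule that)
    show "edge_energy G \<phi> p = (\<Sum>j=1..CARD(3). sq (C (f j)))"
      using sum.reindex_bij_betw[OF f, of "\<lambda>i. sq (C i)"] sum by simp
  qed (simp add: ker)
qed

section \<open>The singular cone and the Rayleigh quotient\<close>

text \<open>
  A Neumann edge needs an odd multiple of \<open>\<pi>/2\<close>. The entry of the matrix on a terminal edge does not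
  depend on its phase, so only the phase \<open>0\<close> on the internal edges matters.
\<close>

lemma B0_is_singular_sector:
  fixes G :: "('i::finite, 'x, 'e::finite) quantum_graph"
  obtains \<theta> where "singular_sector G \<theta>" "Bsing G \<theta> = B0 G"
proof
  let ?\<theta> = "\<chi> e. (case tgt G e of Inl w \<Rightarrow> 0
      | Inr x \<Rightarrow> (case bc G x of Dirichlet \<Rightarrow> 0 | Neumann \<Rightarrow> pi / 2)) :: real ^ 'e"
  have "0 \<in> pi_multiples" unfolding pi_multiples_def by (auto intro: exI[of _ 0])
  then show "singular_sector G ?\<theta>"
    by (auto simp: singular_sector_def split: sum.split boundary_condition.split)
  show "Bsing G ?\<theta> = B0 G"
    by (auto simp: Bsing_def B0_def vec_eq_iff)
qed

lemma sq_kernel_B0_in_singular_cone: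
  assumes "A \<in> kernel (B0 G)"
  shows "sq A \<in> singular_cone G"
proof -
  obtain \<theta> where "singular_sector G \<theta>" "Bsing G \<theta> = B0 G" by (rule B0_is_singular_sector)
  then show ?thesis unfolding singular_cone_def using assms by (intro hull_inc) auto
qed

text \<open>
  The inequality is stated without a quotient because it then holds for the zero vector as well and
  can be summed.
\<close>

lemma C_sing_le_kernel_B0:
  fixes G :: "('i::finite, 'x, 'e::finite) quantum_graph"
  assumes A: "A \<in> kernel (B0 G)" and l: "\<And>e. 0 < l $ e" and \<alpha>: "\<And>e. 0 \<le> \<alpha> $ e"
  shows "C_sing G \<alpha> l * (l \<bullet> sq A) \<le> \<alpha> \<bullet> sq A"
proof (cases "A = 0")
  case True
  then have "sq A = 0" by (simp add: sq_def vec_eq_iff)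
  then show ?thesis by simp
next
  case False
  obtain \<theta> where \<theta>: "singular_sector G \<theta>" "Bsing G \<theta> = B0 G" by (rule B0_is_singular_sector)
  let ?q = "\<lambda>A. (\<Sum>e\<in>UNIV. \<alpha> $ e * (A $ e)\<^sup>2) / (\<Sum>e\<in>UNIV. l $ e * (A $ e)\<^sup>2)"
  have "C_sing G \<alpha> l \<le> sector_inf G \<alpha> l \<theta>"
    unfolding C_sing_def using \<theta> A False by (intro Min_le finite_sector_inf imageI) auto
  also have "\<dots> \<le> ?q A"
    unfolding sector_inf_def
  proof (rule cINF_lower)
    have "0 \<le> ?q B" for B :: "real ^ 'e"
      using l \<alpha> by (intro divide_nonneg_nonneg sum_nonneg) (auto simp: less_imp_le)
    then show "bdd_below (?q ` (kernel (Bsing G \<theta>) - {0}))" by (intro bdd_belowI[of _ 0]) auto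
    show "A \<in> kernel (Bsing G \<theta>) - {0}" using \<theta> A False by simp
  qed
  also have "\<dots> = (\<alpha> \<bullet> sq A) / (l \<bullet> sq A)" by (simp add: inner_vec_def sq_def)
  finally have "C_sing G \<alpha> l \<le> (\<alpha> \<bullet> sq A) / (l \<bullet> sq A)" .
  moreover have "0 < l \<bullet> sq A"
  proof -
    obtain e where "A $ e \<noteq> 0" using False by (auto simp: vec_eq_iff)
    then show ?thesis unfolding inner_vec_def
      using l by (intro sum_pos2[of _ e]) (auto simp: sq_def less_imp_le)
  qed
  ultimately show ?thesis by (simp add: pos_le_divide_eq)
qed

lemma inner_edge_energy_pos:
  fixes G :: "('i::finite, 'x, 'e::finite) quantum_graph"
  assumes tree: "quantum_tree G" and state: "regular_secular_state G \<theta> \<phi> p"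
    and l: "\<And>e. 0 < l $ e"
  shows "0 < l \<bullet> edge_energy G \<phi> p"
proof -
  have "\<exists>v e. incident G v e \<and> (\<phi> v \<noteq> 0 \<or> p v e \<noteq> 0)"
  proof -
    have "{e. incident G v e} \<noteq> {}" for v
    proof
      assume "{e. incident G v e} = {}"
      then show False using card_incident[OF tree, of v] by simp
    qed
    moreover have "(\<exists>v. \<phi> v \<noteq> 0) \<or> (\<exists>v e. incident G v e \<and> p v e \<noteq> 0)"
      using state by (simp add: regular_secular_state_def)
    ultimately show ?thesis by blast
  qed
  then obtain v e where ve: "incident G v e" "\<phi> v \<noteq> 0 \<or> p v e \<noteq> 0" by blast
  have "0 < edge_energy G \<phi> p $ e"
    using ve(2) by (auto simp: edge_energy_incident[OF state ve(1)] sum_power2_gt_zero_iff)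
  then show ?thesis unfolding inner_vec_def
    using l by (intro sum_pos2[of _ e]) (auto simp: edge_energy_def less_imp_le)
qed

theorem theorem5p6:
  fixes G :: "('i::finite, 'x::finite, 'e::finite) quantum_graph"
    and l \<theta> r :: "real ^ 'e"
    and \<phi> :: "'i \<Rightarrow> real"
    and p :: "'i \<Rightarrow> 'e \<Rightarrow> real"
  assumes tree: "quantum_tree G"
    and lengths: "\<forall>e. 0 < l $ e"
    and state: "regular_secular_state G \<theta> \<phi> p"
    and energy: "r = edge_energy G \<phi> p"
  shows "r \<in> singular_cone G \<and>
    (\<exists>N A. (\<forall>j\<in>{1..N::nat}. A j \<in> kernel (B0 G)) \<and> r = (\<Sum>j=1..N. sq (A j))) \<and>
    (\<forall>\<alpha>. (\<forall>e. 0 \<le> \<alpha> $ e) \<longrightarrow> (\<alpha> \<bullet> r) / (l \<bullet> r) \<ge> C_sing G \<alpha> l)"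
proof -
  obtain N :: nat and A where A: "\<And>j. j \<in> {1..N} \<Longrightarrow> A j \<in> kernel (B0 G)"
    and r: "r = (\<Sum>j=1..N. sq (A j))"
    using edge_energy_decomposition[OF tree state] energy by metis
  have "(\<Sum>j\<in>J. sq (A j)) \<in> singular_cone G" if "J \<subseteq> {1..N}" for J
    using finite_subset[OF that finite_atLeastAtMost] that
  proof (induction J rule: finite_induct)
    case empty
    show ?case by (simp add: singular_cone_def convex_cone_hull_contains_0)
  next
    case (insert j J)
    then have "sq (A j) \<in> singular_cone G" by (intro sq_kernel_B0_in_singular_cone A) auto
    with insert show ?case by (simp add: singular_cone_def convex_cone_hull_add)
  qed
  then have "r \<in> singular_cone G" by (simp add: r)
  moreover have "C_sing G \<alpha> l \<le> (\<alpha> \<bullet> r) / (l \<bullet> r)" if "\<forall>e. 0 \<le> \<alpha> $ e" for \<alpha>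
  proof -
    have "C_sing G \<alpha> l * (l \<bullet> r) = (\<Sum>j=1..N. C_sing G \<alpha> l * (l \<bullet> sq (A j)))"
      by (simp add: r inner_sum_right sum_distrib_left)
    also have "\<dots> \<le> (\<Sum>j=1..N. \<alpha> \<bullet> sq (A j))"
      using that lengths by (intro sum_mono C_sing_le_kernel_B0 A) auto
    also have "\<dots> = \<alpha> \<bullet> r" by (simp add: r inner_sum_right)
    finally show ?thesis
      using inner_edge_energy_pos[OF tree state] lengths energy by (simp add: pos_le_divide_eq)
  qed
  ultimately show ?thesis using A r by blast
qed

end
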